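(* Let $K \ge 2$ be a fixed number of folds, and consider the asymptotic regime where the sample size $n \to \infty$. For each $n$, let $W^{(1)}_n, \ldots, W^{(K)}_n$ denote the data in the $K$ folds, let $\hat\tau^{(1:(k-1))}_n$ (for $k = 2, \ldots, K$) be the treatment effect estimate computed from $W^{(1)}_n, \ldots, W^{(k-1)}_n$, and let $T_{k,n}$ (for $k = 2, \ldots, K$) be the real-valued test statistic computed from $W^{(k)}_n$ and $\hat\tau^{(1:(k-1))}_n$, as in the sequential validation procedure described in the context. Suppose that the null hypothesis holds, and that: (i) for each $n$, the data $W^{(1)}_n, \ldots, W^{(K)}_n$ from the $K$ folds are independent of each other; (ii) for each $k = 2, \ldots, K$, the test statistic is valid under the null, i.e., $T_{k,n} \Rightarrow \mathcal{N}(0,1)$ conditionally on $\hat\tau^{(1:(k-1))}_n$, meaning that for every $t \in \mathbb{R}$, $$\mathbb{P}\left[ T_{k,n} \le t \,\middle|\, \hat\tau^{(1:(k-1))}_n \right] \to \Phi(t) \quad \text{in probability as } n \to \infty .$$ Define the sequential $p$-value $$p_{seq,n} = 2\,\Phi\left( - \left| \frac{1}{\sqrt{K-1}} \sum_{k=2}^{K} T_{k,n} \right| \right).$$ Then, under the null, $p_{seq,n} \Rightarrow \operatorname{Unif}([0,1])$ as $n \to \infty$, i.e., $p_{seq,n}$ converges in distribution to the uniform distribution on $[0,1]$.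
   Context: Notation: $\Phi$ is the cumulative distribution function of the standard normal distribution $\mathcal{N}(0,1)$, and $\Rightarrow$ denotes convergence in distribution. Setting: data come from a randomized controlled trial on units $i = 1, \ldots, n$ with potential outcomes $Y_i(0), Y_i(1)$, pre-treatment covariates $Z_i$, and binary treatment $D_i \mid Y_i(0), Y_i(1), Z_i \sim \text{Bernoulli}(\pi)$. The analyst observes $(Z_i, Y_i, D_i)$ with $Y_i = Y_i(D_i)$. The conditional average treatment effect is $\tau(z) = \mathbb{E}[Y_i(1) - Y_i(0) \mid Z_i = z]$. Sequential validation procedure: 1. Randomly split the data into $K$ evenly sized folds; $W^{(k)}_n$ denotes the collection of observations $(Z_i, Y_i, D_i)$ belonging to fold $k$. 2. For each $k = 2, \ldots, K$, obtain an estimate $\hat\tau^{(1:(k-1))}_n(\cdot)$ of $\tau(\cdot)$ by applying an arbitrary method to the data from folds $1, \ldots, k-1$; that is, $\hat\tau^{(1:(k-1))}_n$ is a random element (of some measurable space of functions) that is a measurable function of $(W^{(1)}_n, \ldots, W^{(k-1)}_n)$. 3. Evaluate $\hat\tau^{(1:(k-1))}_n(Z_i)$ for each observation $i$ in fold $k$. 4. Use these evaluations together with the data from fold $k$ to produce a real-valued test statistic $T_{k,n}$; that is, $T_{k,n}$ is a measurable function of $(W^{(k)}_n, \hat\tau^{(1:(k-1))}_n)$. The null hypothesis is that there is no treatment heterogeneity (explained by the estimates). It enters the result only through assumption (ii): the probability distribution under consideration is one for which the null holds, and (ii) states the validity of each test statistic under that distribution. *)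

theory Defs
  imports "HOL-Probability.Probability" "HOL-Combinatorics.Permutations"
begin

definition Phi :: "real \<Rightarrow> real" where
  "Phi = cdf std_normal_distribution"

text \<open>Convergence in probability to a constant; the probability space may change with \<open>n\<close>.\<close>

definition tendsto_in_prob :: "(nat \<Rightarrow> 'w measure) \<Rightarrow> (nat \<Rightarrow> 'w \<Rightarrow> real) \<Rightarrow> real \<Rightarrow> bool" where
  "tendsto_in_prob M X c \<longleftrightarrow>
     (\<forall>\<epsilon>>0. (\<lambda>n. measure (M n) {\<omega> \<in> space (M n). \<epsilon> < \<bar>X n \<omega> - c\<bar>}) \<longlonglongrightarrow> 0)"

definition gen_alg :: "'w measure \<Rightarrow> 'b measure \<Rightarrow> ('w \<Rightarrow> 'b) \<Rightarrow> 'w measure" where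
  "gen_alg M N X = vimage_algebra (space M) X N"

definition cond_prob_given ::
  "'w measure \<Rightarrow> 'b measure \<Rightarrow> ('w \<Rightarrow> 'b) \<Rightarrow> ('w \<Rightarrow> bool) \<Rightarrow> 'w \<Rightarrow> real" where
  "cond_prob_given M N X P =
     real_cond_exp M (gen_alg M N X) (indicator {\<omega> \<in> space M. P \<omega>})"

text \<open>
  A randomized controlled trial on the units \<open>1, \<dots>, n\<close>. \<open>Y i d\<close> is the potential outcome of
  unit \<open>i\<close> under treatment status \<open>d\<close>, and \<open>D i\<close> is the assigned treatment.
\<close>

locale rct = prob_space M
  for M :: "'w measure" +
  fixes n :: nat
    and Zs :: "'z measure"
    and Z :: "nat \<Rightarrow> 'w \<Rightarrow> 'z"
    and Y :: "nat \<Rightarrow> bool \<Rightarrow> 'w \<Rightarrow> real"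
    and D :: "nat \<Rightarrow> 'w \<Rightarrow> bool"
    and \<pi> :: real
    and \<tau> :: "'z \<Rightarrow> real"
  assumes Z_measurable: "\<And>i. i \<in> {1..n} \<Longrightarrow> Z i \<in> M \<rightarrow>\<^sub>M Zs"
    and Y_measurable: "\<And>i d. i \<in> {1..n} \<Longrightarrow> Y i d \<in> borel_measurable M"
    and D_measurable: "\<And>i. i \<in> {1..n} \<Longrightarrow> D i \<in> M \<rightarrow>\<^sub>M count_space UNIV"
    and \<pi>_range: "0 \<le> \<pi>" "\<pi> \<le> 1"
    and treatment_bernoulli: "\<And>i. i \<in> {1..n} \<Longrightarrow>
      AE \<omega> in M. cond_prob_given M (borel \<Otimes>\<^sub>M borel \<Otimes>\<^sub>M Zs)
        (\<lambda>\<omega>. (Y i False \<omega>, Y i True \<omega>, Z i \<omega>)) (D i) \<omega> = \<pi>"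
    and effect_integrable: "\<And>i. i \<in> {1..n} \<Longrightarrow> integrable M (\<lambda>\<omega>. Y i True \<omega> - Y i False \<omega>)"
    and cate_measurable: "\<tau> \<in> borel_measurable Zs"
    and cate: "\<And>i. i \<in> {1..n} \<Longrightarrow>
      AE \<omega> in M. real_cond_exp M (gen_alg M Zs (Z i)) (\<lambda>\<omega>. Y i True \<omega> - Y i False \<omega>) \<omega> = \<tau> (Z i \<omega>)"

definition observation ::
  "(nat \<Rightarrow> 'w \<Rightarrow> 'z) \<Rightarrow> (nat \<Rightarrow> bool \<Rightarrow> 'w \<Rightarrow> real) \<Rightarrow> (nat \<Rightarrow> 'w \<Rightarrow> bool) \<Rightarrow> nat \<Rightarrow> 'w \<Rightarrow> 'z \<times> real \<times> bool"
where
  "observation Z Y D i \<omega> = (Z i \<omega>, Y i (D i \<omega>) \<omega>, D i \<omega>)"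

text \<open>
  The random split: the positions \<open>1, \<dots>, n\<close> are divided into \<open>K\<close> fixed blocks \<open>B 1, \<dots>, B K\<close>
  whose sizes differ by at most one, and the units are placed in these positions by a uniformly
  random permutation \<open>\<sigma>\<close> which is independent of the trial. Fold \<open>k\<close> consists of the units
  \<open>\<sigma> j\<close> with \<open>j \<in> B k\<close>.
\<close>

locale random_split = rct M n Zs Z Y D \<pi> \<tau>
  for M :: "'w measure" and n and Zs :: "'z measure" and Z Y D \<pi> \<tau> +
  fixes K :: nat
    and B :: "nat \<Rightarrow> nat set"
    and \<sigma> :: "'w \<Rightarrow> nat \<Rightarrow> nat"
  assumes blocks_disjoint: "disjoint_family_on B {1..K}"
    and blocks_cover: "(\<Union>k\<in>{1..K}. B k) = {1..n}"
    and blocks_even: "\<And>j k. j \<in> {1..K} \<Longrightarrow> k \<in> {1..K} \<Longrightarrow> card (B j) \<le> card (B k) + 1"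
    and perm_measurable: "\<sigma> \<in> M \<rightarrow>\<^sub>M count_space {p. p permutes {1..n}}"
    and perm_uniform: "distr M (count_space {p. p permutes {1..n}}) \<sigma> =
      uniform_count_measure {p. p permutes {1..n}}"
    and perm_indep: "indep_set
      (sets (gen_alg M (count_space {p. p permutes {1..n}}) \<sigma>))
      (sets (gen_alg M (\<Pi>\<^sub>M i\<in>{1..n}. borel \<Otimes>\<^sub>M borel \<Otimes>\<^sub>M Zs \<Otimes>\<^sub>M count_space UNIV)
        (\<lambda>\<omega>. \<lambda>i\<in>{1..n}. (Y i False \<omega>, Y i True \<omega>, Z i \<omega>, D i \<omega>))))"

text \<open>
  The data of a fold record the observations by position rather than by unit. Recording the
  unit labels would make the data of different folds dependent, since they determine
  which units the other folds contain.
\<close>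

definition fold_data ::
  "nat set \<Rightarrow> ('w \<Rightarrow> nat \<Rightarrow> nat) \<Rightarrow> (nat \<Rightarrow> 'w \<Rightarrow> 'o) \<Rightarrow> 'w \<Rightarrow> nat \<Rightarrow> 'o" where
  "fold_data A \<sigma> obs \<omega> = (\<lambda>j\<in>A. obs (\<sigma> \<omega> j) \<omega>)"

definition fold_space :: "'z measure \<Rightarrow> nat set \<Rightarrow> (nat \<Rightarrow> 'z \<times> real \<times> bool) measure" where
  "fold_space Zs A = (\<Pi>\<^sub>M j\<in>A. Zs \<Otimes>\<^sub>M borel \<Otimes>\<^sub>M count_space UNIV)"

text \<open>The argument \<open>T\<close> lists the statistics \<open>T 2, \<dots>, T K\<close>.\<close>

definition seq_p_value :: "nat \<Rightarrow> (nat \<Rightarrow> real) \<Rightarrow> real" where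
  "seq_p_value K T = 2 * Phi (- \<bar>1 / sqrt (real K - 1) * (\<Sum>k=2..K. T k)\<bar>)"

end

theory Submission
  imports Defs
begin

text \<open>
  Folds \<open>1, \<dots>, k-1\<close> enter \<open>T k\<close> only through the estimate, which is independent of fold \<open>k\<close>. So the
  conditional cdf of \<open>T k\<close> given the estimate is, almost surely, the cdf of \<open>T k\<close> with the estimate
  frozen, and it is also the conditional cdf given all previous folds. By (ii) these random cdfs
  converge to \<open>\<Phi>\<close> in probability at every point; closeness at finitely many points forces the
  characteristic functions to be close, so the frozen characteristic functions converge in \<open>L\<^sup>1\<close>
  to that of the normal law. Adding one statistic at a time then multiplies the limit of the
  characteristic function of the partial sums by \<open>exp (- \<theta>\<^sup>2 / 2)\<close>, and Levy's continuity theorem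
  and the continuous mapping theorem for \<open>x \<mapsto> 2 * \<Phi> (- \<bar>x\<bar>)\<close> conclude.
\<close>


section \<open>The standard normal cdf and the law of the two-sided p-value\<close>

lemma Phi_nonneg: "0 \<le> Phi x"
  unfolding Phi_def cdf_def by simp

text \<open>The normal density is positive everywhere, so the normal law and Lebesgue measure have
  the same null sets. Single points give the continuity of \<open>Phi\<close>, nonempty intervals
  its strict monotonicity.\<close>

lemma std_normal_null_iff:
  assumes "A \<in> sets borel"
  shows "measure std_normal_distribution A = 0 \<longleftrightarrow> emeasure lborel A = 0"
proof -
  interpret real_distribution std_normal_distribution by (rule real_dist_normal_dist)
  have "measure std_normal_distribution A = 0 \<longleftrightarrow> A \<in> null_sets std_normal_distribution"
    using assms by (auto simp: null_sets_def emeasure_eq_measure)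
  also have "\<dots> \<longleftrightarrow> (AE x in lborel. x \<in> A \<longrightarrow> ennreal (std_normal_density x) = 0)"
    using assms by (subst null_sets_density_iff) auto
  also have "\<dots> \<longleftrightarrow> (AE x in lborel. x \<notin> A)"
    using normal_density_pos[of 1 0] by (simp add: ennreal_eq_0_iff not_le[symmetric])
  also have "\<dots> \<longleftrightarrow> emeasure lborel A = 0"
    using assms by (subst AE_iff_measurable[of A]) auto
  finally show ?thesis .
qed

lemma isCont_Phi: "isCont Phi x"
proof -
  interpret real_distribution std_normal_distribution by (rule real_dist_normal_dist)
  show ?thesis
    unfolding Phi_def isCont_cdf by (subst std_normal_null_iff) auto
qed

lemma isCont_two_sided_p_value: "isCont (\<lambda>x. 2 * Phi (- \<bar>x\<bar>)) x"
proof -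
  have "isCont (\<lambda>x :: real. - \<bar>x\<bar>) x" by (intro continuous_intros)
  from isCont_o2[OF this isCont_Phi] show ?thesis by (rule continuous_mult_left)
qed

lemma Phi_strict_mono: "strict_mono Phi"
proof (rule strict_monoI)
  interpret real_distribution std_normal_distribution by (rule real_dist_normal_dist)
  fix x y :: real assume "x < y"
  moreover have "measure std_normal_distribution {x<..y} \<noteq> 0"
    using \<open>x < y\<close> by (subst std_normal_null_iff) auto
  ultimately show "Phi x < Phi y"
    unfolding Phi_def using cdf_diff_eq[of x y] measure_nonneg[of std_normal_distribution "{x<..y}"] by linarith
qed

text \<open>Reflection turns the characteristic function at \<open>t\<close> into its value at
  \<open>- t\<close>, and \<open>exp (- t\<^sup>2 / 2)\<close> is even.\<close>

lemma distr_std_normal_uminus: "distr std_normal_distribution borel uminus = std_normal_distribution"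
proof (rule Levy_uniqueness)
  interpret real_distribution std_normal_distribution by (rule real_dist_normal_dist)
  show "real_distribution (distr std_normal_distribution borel uminus)" by simp
  show "real_distribution std_normal_distribution" by (rule real_dist_normal_dist)
  have "char (distr std_normal_distribution borel uminus) t = char std_normal_distribution (- t)" for t
    unfolding char_def by (subst integral_distr) auto
  then show "char (distr std_normal_distribution borel uminus) = char std_normal_distribution"
    by (simp add: char_std_normal_distribution fun_eq_iff)
qed

lemma measure_std_normal_ge: "measure std_normal_distribution {x..} = Phi (- x)"
proof -
  have "Phi (- x) = measure (distr std_normal_distribution borel uminus) {.. - x}"
    by (simp add: distr_std_normal_uminus Phi_def cdf_def)
  also have "\<dots> = measure std_normal_distribution (uminus -` {.. - x})"
    by (subst measure_distr) auto
  also have "uminus -` {.. - x} = {x..}" by auto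
  finally show ?thesis ..
qed

lemma Phi_0: "Phi 0 = 1 / 2"
proof -
  interpret real_distribution std_normal_distribution by (rule real_dist_normal_dist)
  have "{..<0::real} \<union> {0..} = UNIV" by auto
  then have "1 = measure std_normal_distribution ({..<0} \<union> {0..})"
    using prob_space by simp
  also have "\<dots> = measure std_normal_distribution {..<0} + Phi 0"
    by (subst finite_measure_Union) (auto simp: measure_std_normal_ge)
  \<comment> \<open>The mass of the open half-line is the left limit of the cdf at 0, which is
    \<open>Phi 0\<close> by continuity.\<close>
  also have "measure std_normal_distribution {..<0} = Phi 0"
  proof (rule tendsto_unique[OF _ cdf_at_left])
    show "(cdf std_normal_distribution \<longlongrightarrow> Phi 0) (at_left 0)"
      using isCont_Phi[of 0] by (simp add: Phi_def isCont_def filterlim_at_split)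
  qed simp
  finally show ?thesis by simp
qed

text \<open>For \<open>u\<close> strictly between 0 and 1, the value is at most \<open>u\<close>
  exactly on the two tails cut off at the \<open>u / 2\<close> quantile; each tail has mass
  \<open>u / 2\<close> by symmetry.\<close>

lemma std_normal_two_sided_p_value:
  "distr std_normal_distribution borel (\<lambda>x. 2 * Phi (- \<bar>x\<bar>)) = uniform_measure lborel {0..1}"
proof (rule cdf_unique)
  interpret N: real_distribution std_normal_distribution by (rule real_dist_normal_dist)
  have [measurable]: "Phi \<in> borel_measurable borel"
    by (intro borel_measurable_continuous_onI continuous_at_imp_continuous_on ballI isCont_Phi)
  let ?P = "distr std_normal_distribution borel (\<lambda>x. 2 * Phi (- \<bar>x\<bar>))"
  let ?U = "uniform_measure lborel {0..1::real}"
  show "real_distribution ?P" by simp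
  then interpret P: real_distribution ?P .
  have "prob_space ?U" by (rule prob_space_uniform_measure) auto
  then show "real_distribution ?U"
    by (simp add: real_distribution_def real_distribution_axioms_def)
  then interpret U: real_distribution ?U .
  show "cdf ?P = cdf ?U"
  proof
    fix u
    have P: "cdf ?P u = measure std_normal_distribution {x. 2 * Phi (- \<bar>x\<bar>) \<le> u}"
      unfolding cdf_def by (subst measure_distr) (auto simp: vimage_def)
    \<comment> \<open>These two bounds put the p-value above 0 and at or below 1, which settles
      every \<open>u\<close> outside the open unit interval.\<close>
    have Phi_pos: "0 < Phi y" for y
      using Phi_nonneg[of "y - 1"] strict_monoD[OF Phi_strict_mono, of "y - 1" y] by simp
    have Phi_half: "Phi (- \<bar>x\<bar>) \<le> 1 / 2" for x
      using monoD[OF strict_mono_mono[OF Phi_strict_mono], of "- \<bar>x\<bar>" 0] by (simp add: Phi_0)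
    have "{x. 2 * Phi (- \<bar>x\<bar>) \<le> u} = {}" if "u \<le> 0"
    proof (rule Collect_empty_eq[THEN iffD2], rule allI)
      fix x show "\<not> 2 * Phi (- \<bar>x\<bar>) \<le> u" using Phi_pos[of "- \<bar>x\<bar>"] that by simp
    qed
    moreover have "{x. 2 * Phi (- \<bar>x\<bar>) \<le> u} = UNIV" if "1 \<le> u"
    proof (rule UNIV_eq_I[symmetric], rule CollectI)
      fix x show "2 * Phi (- \<bar>x\<bar>) \<le> u" using Phi_half[of x] that by simp
    qed
    ultimately consider "u \<le> 0" "{x. 2 * Phi (- \<bar>x\<bar>) \<le> u} = {}" | "1 \<le> u" "{x. 2 * Phi (- \<bar>x\<bar>) \<le> u} = UNIV"
      | "0 < u" "u < 1"
      by linarith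
    then show "cdf ?P u = cdf ?U u"
    proof cases
      case 1
      then have "cdf ?U u \<le> cdf ?U 0" by (intro U.cdf_nondecreasing)
      also have "cdf ?U 0 = 0"
        by (simp add: cdf_def)
      finally show ?thesis using 1 U.cdf_nonneg[of u] by (simp add: P)
    next
      case 2
      have "1 = cdf ?U 1" by (simp add: cdf_def) 
      also have "\<dots> \<le> cdf ?U u" using 2 by (intro U.cdf_nondecreasing)
      finally show ?thesis using 2 U.cdf_bounded_prob[of u] N.prob_space by (simp add: P)
    next
      case 3
      \<comment> \<open>The quantile \<open>q\<close> comes from the intermediate value theorem
        between a point far to the left, where \<open>Phi\<close> is below \<open>u / 2\<close>, and
        0, where it is \<open>1 / 2\<close>.\<close>
      have "(Phi \<longlongrightarrow> 0) at_bot" unfolding Phi_def by (rule N.cdf_lim_at_bot)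
      then have "eventually (\<lambda>x. Phi x < u / 2) at_bot" using 3 by (intro order_tendstoD) auto
      then have "eventually (\<lambda>x. Phi x < u / 2 \<and> x \<le> 0) at_bot"
        by (intro eventually_conj eventually_le_at_bot)
      then obtain a where a: "Phi a < u / 2" "a \<le> 0"
        by (auto dest: eventually_happens)
      have "\<exists>q. a \<le> q \<and> q \<le> 0 \<and> Phi q = u / 2"
        using a 3 by (intro IVT) (auto simp: isCont_Phi Phi_0)
      then obtain q where q: "q \<le> 0" "Phi q = u / 2" by auto
      \<comment> \<open>This uses \<open>u < 1\<close> and makes the two tails disjoint.\<close>
      then have "q \<noteq> 0" using 3 by (auto simp: Phi_0)
      have "2 * Phi y \<le> u \<longleftrightarrow> y \<le> q" for y
        using strict_mono_less_eq[OF Phi_strict_mono, of y q] q(2) by linarith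
      then have "{x. 2 * Phi (- \<bar>x\<bar>) \<le> u} = {x. - \<bar>x\<bar> \<le> q}" by (simp only:)
      also have "\<dots> = {..q} \<union> {- q..}"
        using \<open>q \<le> 0\<close> by auto
      finally have "{x. 2 * Phi (- \<bar>x\<bar>) \<le> u} = {..q} \<union> {- q..}" .
      then have "cdf ?P u = measure std_normal_distribution ({..q} \<union> {- q..})"
        by (simp add: P)
      also have "\<dots> = Phi q + Phi q"
        using \<open>q \<le> 0\<close> \<open>q \<noteq> 0\<close>
        by (subst N.finite_measure_Union) (auto simp: measure_std_normal_ge Phi_def cdf_def)
      also have "\<dots> = measure lborel {0..u}" using 3 q by simp
      also have "{0..u} = {0..1} \<inter> {..u}" using 3 by auto
      also have "measure lborel ({0..1} \<inter> {..u}) = cdf ?U u"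
        by (simp add: cdf_def measure_uniform_measure)
      finally show ?thesis .
    qed
  qed
qed

section \<open>Weak convergence and characteristic functions\<close>

text \<open>A bounded continuous test function composed with \<open>f\<close> is again bounded and
  continuous, so integrals against the image laws converge.\<close>

lemma weak_conv_distr_continuous:
  fixes f :: "real \<Rightarrow> real"
  assumes \<mu>: "\<And>n. real_distribution (\<mu> n)" and \<nu>: "real_distribution \<nu>"
    and conv: "weak_conv_m \<mu> \<nu>" and f: "\<And>x. isCont f x"
  shows "weak_conv_m (\<lambda>n. distr (\<mu> n) borel f) (distr \<nu> borel f)"
proof -
  interpret \<mu>: real_distribution "\<mu> n" for n by (rule \<mu>)
  interpret \<nu>: real_distribution \<nu> by (rule \<nu>)
  have f_meas: "f \<in> borel_measurable borel"
    by (intro borel_measurable_continuous_onI continuous_at_imp_continuous_on ballI f)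
  then have [measurable]: "f \<in> borel_measurable (\<mu> n)" "f \<in> borel_measurable \<nu>" for n
    by simp_all
  show ?thesis
  proof (rule integral_bdd_continuous_conv_imp_weak_conv)
    fix g :: "real \<Rightarrow> real"
    assume g: "\<And>x. isCont g x" "\<And>x. \<bar>g x\<bar> \<le> 1"
    have [measurable]: "g \<in> borel_measurable borel"
      by (intro borel_measurable_continuous_onI continuous_at_imp_continuous_on ballI g)
    have "(\<lambda>n. \<integral>x. g (f x) \<partial>\<mu> n) \<longlonglongrightarrow> (\<integral>x. g (f x) \<partial>\<nu>)"
      using g f by (intro weak_conv_imp_integral_bdd_continuous_conv[OF \<mu> \<nu> conv, of _ 1]
          isCont_o2[where f = f and g = g]) auto
    then show "(\<lambda>n. integral\<^sup>L (distr (\<mu> n) borel f) g) \<longlonglongrightarrow> integral\<^sup>L (distr \<nu> borel f) g"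
      by (simp add: integral_distr)
  qed (simp_all add: f_meas)
qed

text \<open>This is a uniform form of the continuity of characteristic functions: \<open>S\<close>
  and \<open>\<delta>\<close> depend on \<open>\<nu>\<close>, \<open>\<theta>\<close> and
  \<open>e\<close>, but not on \<open>\<mu>\<close>. It can therefore be applied to a random law,
  outcome by outcome, once its cdf is controlled at finitely many points.\<close>

lemma char_close_of_cdf_close:
  assumes \<nu>: "real_distribution \<nu>" and cont: "\<And>x. isCont (cdf \<nu>) x" and e: "0 < (e::real)"
  obtains S :: "real set" and \<delta> :: real where "finite S" "0 < \<delta>"
    "\<And>\<mu>. real_distribution \<mu> \<Longrightarrow> (\<And>t. t \<in> S \<Longrightarrow> \<bar>cdf \<mu> t - cdf \<nu> t\<bar> \<le> \<delta>) \<Longrightarrow>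
       cmod (char \<mu> \<theta> - char \<nu> \<theta>) < e"
proof (rule ccontr)
  assume none: "\<not> thesis"
  \<comment> \<open>A counterexample for every initial segment of an enumeration of the rationals gives a sequence
    that converges weakly to \<open>\<nu>\<close>, although its characteristic functions stay away from that of \<open>\<nu>\<close>.\<close>
  obtain r :: "nat \<Rightarrow> real" where r: "range r = \<rat>"
    using range_from_nat_into[OF _ countable_rat] Rats_0 by blast
  \<comment> \<open>One index governs both the points and the tolerance: a fixed rational is tested
    at every late stage, while the tolerance vanishes.\<close>
  define close where "close m \<mu> \<longleftrightarrow> (\<forall>i\<le>m. \<bar>cdf \<mu> (r i) - cdf \<nu> (r i)\<bar> \<le> 1 / real (Suc m))" for m \<mu>
  define bad where "bad m \<mu> \<longleftrightarrow> real_distribution \<mu> \<and> close m \<mu> \<and> e \<le> cmod (char \<mu> \<theta> - char \<nu> \<theta>)" for m \<mu>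
  have "\<exists>\<mu>. bad m \<mu>" for m
  proof (rule ccontr)
    assume no_bad: "\<nexists>\<mu>. bad m \<mu>"
    show False
    \<comment> \<open>Without a bad law at stage \<open>m\<close>, the points
      \<open>r 0, ..., r m\<close> and this tolerance would be an admissible choice of
      \<open>S\<close> and \<open>\<delta>\<close>.\<close>
    proof (rule notE[OF none], rule that[of "r ` {..m}" "1 / real (Suc m)"])
      fix \<mu> assume \<mu>: "real_distribution \<mu>" "\<And>t. t \<in> r ` {..m} \<Longrightarrow> \<bar>cdf \<mu> t - cdf \<nu> t\<bar> \<le> 1 / real (Suc m)"
      then have "close m \<mu>" by (simp add: close_def)
      moreover have "\<not> bad m \<mu>" using no_bad by simp
      ultimately show "cmod (char \<mu> \<theta> - char \<nu> \<theta>) < e" using \<mu>(1) by (simp add: bad_def)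
    qed simp_all
  qed
  then have "\<exists>\<mu>. \<forall>m. bad m (\<mu> m)" by (intro choice allI)
  then obtain \<mu> where bad: "\<And>m. bad m (\<mu> m)" by auto
  have \<mu>: "real_distribution (\<mu> m)" "close m (\<mu> m)"
    and far: "e \<le> cmod (char (\<mu> m) \<theta> - char \<nu> \<theta>)" for m
    using bad[of m] by (simp_all add: bad_def)
  have rat: "(\<lambda>m. cdf (\<mu> m) q) \<longlonglongrightarrow> cdf \<nu> q" if "q \<in> \<rat>" for q
  proof -
    have "q \<in> range r" using that r by simp
    then obtain i where i: "q = r i" by auto
    have "(\<lambda>m. cdf (\<mu> m) q - cdf \<nu> q) \<longlonglongrightarrow> 0"
    proof (rule Lim_null_comparison)
      show "\<forall>\<^sub>F m in sequentially. norm (cdf (\<mu> m) q - cdf \<nu> q) \<le> 1 / real (Suc m)"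
        using eventually_ge_at_top[of i] by eventually_elim (use \<mu>(2) in \<open>auto simp: close_def i\<close>)
      show "(\<lambda>m. 1 / real (Suc m)) \<longlonglongrightarrow> 0" by (rule LIMSEQ_Suc) (rule lim_1_over_n)
    qed
    then show ?thesis by (rule Lim_null[THEN iffD2])
  qed
  interpret \<mu>: real_distribution "\<mu> m" for m by (rule \<mu>)
  have "weak_conv_m \<mu> \<nu>"
    unfolding weak_conv_m_def weak_conv_def
  proof (intro allI impI)
    fix x :: real
    show "(\<lambda>m. cdf (\<mu> m) x) \<longlonglongrightarrow> cdf \<nu> x"
    proof (rule tendstoI)
      fix d :: real assume "0 < d"
      \<comment> \<open>By monotonicity, the cdf at \<open>x\<close> is squeezed between its values
        at rationals \<open>a < x < b\<close> so close to \<open>x\<close> that the limit cdf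
        changes by less than \<open>d / 2\<close>; the other \<open>d / 2\<close> is spent on the
        convergence at \<open>a\<close> and \<open>b\<close>.\<close>
      then obtain s where s: "s > 0" "\<And>y. dist y x < s \<Longrightarrow> dist (cdf \<nu> y) (cdf \<nu> x) < d / 2"
        using cont[of x] by (metis continuous_at_eps_delta half_gt_zero)
      obtain a where a: "a \<in> \<rat>" "x - s < a" "a < x"
        using Rats_dense_in_real[of "x - s" x] s by auto
      obtain b where b: "b \<in> \<rat>" "x < b" "b < x + s"
        using Rats_dense_in_real[of x "x + s"] s by auto
      have ab: "dist (cdf \<nu> a) (cdf \<nu> x) < d / 2" "dist (cdf \<nu> b) (cdf \<nu> x) < d / 2"
        by (rule s(2), use a b in \<open>simp add: dist_real_def\<close>)+
      have near: "\<forall>\<^sub>F m in sequentially. dist (cdf (\<mu> m) q) (cdf \<nu> q) < d / 2" if "q \<in> \<rat>" for q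
        using tendstoD[OF rat[OF that] half_gt_zero[OF \<open>0 < d\<close>]] .
      from near[OF a(1)] near[OF b(1)] show "\<forall>\<^sub>F m in sequentially. dist (cdf (\<mu> m) x) (cdf \<nu> x) < d"
      proof eventually_elim
        case (elim m)
        with \<mu>.cdf_nondecreasing[of a x m] \<mu>.cdf_nondecreasing[of x b m] a b ab
        show ?case unfolding dist_real_def by linarith
      qed
    qed
  qed
  then have "(\<lambda>m. char (\<mu> m) \<theta>) \<longlonglongrightarrow> char \<nu> \<theta>"
    by (intro levy_continuity1 \<mu> \<nu>)
  then have "\<forall>\<^sub>F m in sequentially. dist (char (\<mu> m) \<theta>) (char \<nu> \<theta>) < e"
    using e by (rule tendstoD)
  then obtain m where "dist (char (\<mu> m) \<theta>) (char \<nu> \<theta>) < e"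
    by (rule eventually_happens'[OF sequentially_bot, THEN exE])
  then show False
    using far[of m] by (simp add: dist_norm)
qed

section \<open>Freezing an independent variable\<close>

text \<open>Under independence the joint law is a product, and Fubini, applicable as
  \<open>g\<close> is bounded, integrates over \<open>X\<close> while \<open>V\<close> is frozen.
  Both variables share a value type because \<open>indep_var\<close> asks for it.\<close>

lemma (in prob_space) expectation_indep_pair:
  fixes g :: "'b \<times> 'b \<Rightarrow> 'd::{banach, second_countable_topology}"
  assumes indep: "indep_var S X N V" and g[measurable]: "g \<in> borel_measurable (S \<Otimes>\<^sub>M N)"
    and bound: "\<And>z. norm (g z) \<le> b"
  shows "expectation (\<lambda>\<omega>. g (X \<omega>, V \<omega>)) = expectation (\<lambda>\<omega>. \<integral>\<omega>'. g (X \<omega>', V \<omega>) \<partial>M)"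
proof -
  have X[measurable]: "random_variable S X" and V[measurable]: "random_variable N V"
    using indep_var_rv1[OF indep] indep_var_rv2[OF indep] by auto
  interpret X: prob_space "distr M S X" by (rule prob_space_distr) simp
  interpret V: prob_space "distr M N V" by (rule prob_space_distr) simp
  interpret XV: pair_prob_space "distr M S X" "distr M N V" ..
  have "expectation (\<lambda>\<omega>. g (X \<omega>, V \<omega>)) = (\<integral>z. g z \<partial>distr M (S \<Otimes>\<^sub>M N) (\<lambda>\<omega>. (X \<omega>, V \<omega>)))"
    by (simp add: integral_distr)
  also have "\<dots> = (\<integral>z. g z \<partial>(distr M S X \<Otimes>\<^sub>M distr M N V))"
    using indep by (simp add: indep_var_distribution_eq)
  also have "\<dots> = (\<integral>v. (\<integral>x. g (x, v) \<partial>distr M S X) \<partial>distr M N V)"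
  proof -
    have "integrable (distr M S X \<Otimes>\<^sub>M distr M N V) g"
      by (rule XV.integrable_const_bound[where B = b]) (simp_all add: bound)
    then have "integrable (distr M S X \<Otimes>\<^sub>M distr M N V) (case_prod (\<lambda>x v. g (x, v)))"
      by simp
    from XV.integral_snd[OF this] show ?thesis by simp
  qed
  also have "\<dots> = (\<integral>v. (\<integral>\<omega>'. g (X \<omega>', v) \<partial>M) \<partial>distr M N V)"
    by (intro Bochner_Integration.integral_cong refl) (subst integral_distr, auto)
  also have "\<dots> = expectation (\<lambda>\<omega>. \<integral>\<omega>'. g (X \<omega>', V \<omega>) \<partial>M)"
    by (subst integral_distr) auto
  finally show ?thesis .
qed

lemma subalgebra_gen_alg:
  assumes "V \<in> M \<rightarrow>\<^sub>M N"
  shows "subalgebra M (gen_alg M N V)"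
  using assms unfolding subalgebra_def gen_alg_def
  by (auto simp: sets_vimage_algebra2 measurable_space measurable_sets)

lemma (in prob_space) cond_prob_given_indep:
  assumes indep: "indep_var S X N V" and f[measurable]: "f \<in> N \<rightarrow>\<^sub>M F"
    and h[measurable]: "h \<in> borel_measurable (S \<Otimes>\<^sub>M F)"
  shows "AE \<omega> in M. cond_prob_given M F (\<lambda>\<omega>. f (V \<omega>)) (\<lambda>\<omega>. h (X \<omega>, f (V \<omega>)) \<le> (t::real)) \<omega>
    = cdf (distr M borel (\<lambda>\<omega>'. h (X \<omega>', f (V \<omega>)))) t"
proof -
  have X[measurable]: "random_variable S X" and V[measurable]: "random_variable N V"
    using indep_var_rv1[OF indep] indep_var_rv2[OF indep] by auto
  define U where "U \<omega> = f (V \<omega>)" for \<omega>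
  have U_eq: "(\<lambda>\<omega>. f (V \<omega>)) = U" "\<And>\<omega>. f (V \<omega>) = U \<omega>" by (simp_all add: U_def fun_eq_iff)
  have U[measurable]: "random_variable F U" unfolding U_def by measurable
  interpret finite_measure_subalgebra M "gen_alg M F U"
    by unfold_locales (rule subalgebra_gen_alg[OF U])
  define I where "I z = (indicator {..t} (h z) :: real)" for z
  have [measurable]: "I \<in> borel_measurable (S \<Otimes>\<^sub>M F)" unfolding I_def by measurable
  have I_bound: "norm (I z) \<le> 1" for z by (simp add: I_def)
  define c where "c u = (\<integral>\<omega>'. I (X \<omega>', u) \<partial>M)" for u
  have c_meas[measurable]: "c \<in> borel_measurable F" unfolding c_def by measurable
  have c_bound: "norm (c u) \<le> 1" if "u \<in> space F" for u
  proof -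
    have "norm (c u) \<le> (\<integral>\<omega>'. norm (I (X \<omega>', u)) \<partial>M)"
      unfolding c_def by (rule integral_norm_bound)
    also have "\<dots> \<le> 1"
      using that I_bound by (intro integral_le_const integrable_const_bound[where B = 1]) auto
    finally show ?thesis .
  qed
  \<comment> \<open>Membership of \<open>u\<close> in \<open>space F\<close> makes the section of
    \<open>h\<close> at \<open>u\<close> measurable; \<open>U \<omega>\<close> satisfies it
    throughout \<open>space M\<close>.\<close>
  have c_eq: "cdf (distr M borel (\<lambda>\<omega>'. h (X \<omega>', u))) t = c u" if [simp]: "u \<in> space F" for u
  proof -
    have "cdf (distr M borel (\<lambda>\<omega>'. h (X \<omega>', u))) t = measure M {\<omega>' \<in> space M. h (X \<omega>', u) \<le> t}"
      unfolding cdf_def by (subst measure_distr) (auto intro!: arg_cong[where f = "measure M"])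
    also have "\<dots> = (\<integral>\<omega>'. indicator {\<omega>' \<in> space M. h (X \<omega>', u) \<le> t} \<omega>' \<partial>M)"
      by simp
    also have "\<dots> = c u"
      unfolding c_def I_def by (intro Bochner_Integration.integral_cong) (auto simp: indicator_def)
    finally show ?thesis .
  qed
  have "AE \<omega> in M. cond_prob_given M F U (\<lambda>\<omega>. h (X \<omega>, U \<omega>) \<le> t) \<omega> = c (U \<omega>)"
    unfolding cond_prob_given_def
  proof (rule real_cond_exp_charact)
    fix A assume "A \<in> sets (gen_alg M F U)"
    then obtain B where B[measurable]: "B \<in> sets F" and A: "A = U -` B \<inter> space M"
      using U by (auto simp: gen_alg_def sets_vimage_algebra2 measurable_space)
    \<comment> \<open>The indicator of the conditioning event is absorbed into the integrand; as it
      depends on \<open>V\<close> alone, it leaves the inner integral unchanged as a factor.\<close>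
    let ?g = "\<lambda>z. indicator B (f (snd z)) * I (fst z, f (snd z))"
    have bnd: "norm (?g z) \<le> 1" for z
      by (simp add: I_def indicator_def)
    have "(\<integral>\<omega>\<in>A. indicator {\<omega> \<in> space M. h (X \<omega>, U \<omega>) \<le> t} \<omega> \<partial>M) = (\<integral>\<omega>. ?g (X \<omega>, V \<omega>) \<partial>M)"
      unfolding set_lebesgue_integral_def I_def
      by (intro Bochner_Integration.integral_cong) (auto simp: A U_def indicator_def)
    also have "\<dots> = (\<integral>\<omega>. (\<integral>\<omega>'. ?g (X \<omega>', V \<omega>) \<partial>M) \<partial>M)"
      by (rule expectation_indep_pair[OF indep, where b = 1, OF _ bnd]) measurable
    also have "\<dots> = (\<integral>\<omega>\<in>A. c (U \<omega>) \<partial>M)"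
      unfolding set_lebesgue_integral_def c_def
      by (intro Bochner_Integration.integral_cong) (auto simp: A U_def indicator_def)
    finally show "(\<integral>\<omega>\<in>A. indicator {\<omega> \<in> space M. h (X \<omega>, U \<omega>) \<le> t} \<omega> \<partial>M)
        = (\<integral>\<omega>\<in>A. c (U \<omega>) \<partial>M)" .
  next
    show "integrable M (indicator {\<omega> \<in> space M. h (X \<omega>, U \<omega>) \<le> t} :: _ \<Rightarrow> real)"
      by (rule integrable_const_bound[where B = 1]) auto
    show "integrable M (\<lambda>\<omega>. c (U \<omega>))"
      using c_bound measurable_space[OF U] by (intro integrable_const_bound[where B = 1]) auto
    show "(\<lambda>\<omega>. c (U \<omega>)) \<in> borel_measurable (gen_alg M F U)"
      unfolding gen_alg_def using measurable_space[OF U]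
      by (intro measurable_compose[OF measurable_vimage_algebra1 c_meas]) auto
  qed
  moreover have "AE \<omega> in M. U \<omega> \<in> space F"
    using measurable_space[OF U] by (intro AE_I2)
  ultimately show ?thesis
  proof eventually_elim
    case (elim \<omega>)
    then show ?case using c_eq[of "U \<omega>"] U_eq by simp
  qed
qed

text \<open>The exponential of the sum is a product whose first factor depends on \<open>V\<close>
  alone, so freezing \<open>V\<close> pulls it out of the inner integral.\<close>

lemma (in prob_space) char_add_indep:
  fixes s :: "'b \<Rightarrow> real" and h :: "'b \<times> 'b \<Rightarrow> real"
  assumes indep: "indep_var S X N V" and [measurable]: "h \<in> borel_measurable (S \<Otimes>\<^sub>M N)"
    and [measurable]: "s \<in> borel_measurable N"
  shows "char (distr M borel (\<lambda>\<omega>. s (V \<omega>) + h (X \<omega>, V \<omega>))) \<theta>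
    = expectation (\<lambda>\<omega>. iexp (\<theta> * s (V \<omega>)) * char (distr M borel (\<lambda>\<omega>'. h (X \<omega>', V \<omega>))) \<theta>)"
proof -
  have [measurable]: "random_variable S X" and V[measurable]: "random_variable N V"
    using indep_var_rv1[OF indep] indep_var_rv2[OF indep] by auto
  let ?g = "\<lambda>z. iexp (\<theta> * s (snd z)) * iexp (\<theta> * h z)"
  have "char (distr M borel (\<lambda>\<omega>. s (V \<omega>) + h (X \<omega>, V \<omega>))) \<theta>
      = expectation (\<lambda>\<omega>. ?g (X \<omega>, V \<omega>))"
    unfolding char_def by (subst integral_distr) (auto simp: distrib_left exp_add)
  also have "\<dots> = expectation (\<lambda>\<omega>. \<integral>\<omega>'. ?g (X \<omega>', V \<omega>) \<partial>M)"
  proof (rule expectation_indep_pair[OF indep])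
    show "?g \<in> borel_measurable (S \<Otimes>\<^sub>M N)" by measurable
    show "norm (?g z) \<le> 1" for z by (simp add: norm_mult)
  qed
  also have "\<dots> = expectation (\<lambda>\<omega>. iexp (\<theta> * s (V \<omega>)) * char (distr M borel (\<lambda>\<omega>'. h (X \<omega>', V \<omega>))) \<theta>)"
  proof (intro Bochner_Integration.integral_cong refl)
    fix \<omega> assume "\<omega> \<in> space M"
    then have [simp]: "V \<omega> \<in> space N" using measurable_space[OF V] by blast
    have "char (distr M borel (\<lambda>\<omega>'. h (X \<omega>', V \<omega>))) \<theta> = (\<integral>\<omega>'. iexp (\<theta> * h (X \<omega>', V \<omega>)) \<partial>M)"
      unfolding char_def by (subst integral_distr) simp_all
    then show "(\<integral>\<omega>'. ?g (X \<omega>', V \<omega>) \<partial>M)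
        = iexp (\<theta> * s (V \<omega>)) * char (distr M borel (\<lambda>\<omega>'. h (X \<omega>', V \<omega>))) \<theta>"
      by simp
  qed
  finally show ?thesis .
qed

lemma tendsto_in_prob_char:
  fixes M :: "nat \<Rightarrow> 'w measure" and X V :: "nat \<Rightarrow> 'w \<Rightarrow> 'b" and h :: "nat \<Rightarrow> 'b \<times> 'f \<Rightarrow> real"
    and \<theta> :: real
  assumes prob: "\<And>n. prob_space (M n)"
    and indep: "\<And>n. prob_space.indep_var (M n) (S n) (X n) (N n) (V n)"
    and f: "\<And>n. f n \<in> N n \<rightarrow>\<^sub>M F n"
    and h: "\<And>n. h n \<in> borel_measurable (S n \<Otimes>\<^sub>M F n)"
    and valid: "\<And>t. tendsto_in_prob M
      (\<lambda>n. cond_prob_given (M n) (F n) (\<lambda>\<omega>. f n (V n \<omega>)) (\<lambda>\<omega>. h n (X n \<omega>, f n (V n \<omega>)) \<le> t)) (Phi t)"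
  defines "c \<equiv> \<lambda>n \<omega>. char (distr (M n) borel (\<lambda>\<omega>'. h n (X n \<omega>', f n (V n \<omega>)))) \<theta>"
  shows "\<And>n. c n \<in> borel_measurable (M n)"
    and "(\<lambda>n. \<integral>\<omega>. cmod (c n \<omega> - char std_normal_distribution \<theta>) \<partial>M n) \<longlonglongrightarrow> 0"
proof -
  interpret M: prob_space "M n" for n by (rule prob)
  have [measurable]: "X n \<in> M n \<rightarrow>\<^sub>M S n" and V[measurable]: "V n \<in> M n \<rightarrow>\<^sub>M N n" for n
    using M.indep_var_rv1[OF indep] M.indep_var_rv2[OF indep] by auto
  note f[measurable] h[measurable]
  have V_space[simp]: "f n (V n \<omega>) \<in> space (F n)" if "\<omega> \<in> space (M n)" for n \<omega>
    using that measurable_space[OF f] measurable_space[OF V] by blast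
  have meas: "(\<lambda>\<omega>'. h n (X n \<omega>', f n (V n \<omega>))) \<in> borel_measurable (M n)" if "\<omega> \<in> space (M n)" for n \<omega>
    using V_space[OF that] by measurable
  let ?\<phi> = "char std_normal_distribution \<theta>"
  have c_meas[measurable]: "c n \<in> borel_measurable (M n)" for n
  proof -
    have int_meas: "(\<lambda>\<omega>. \<integral>\<omega>'. iexp (\<theta> * h n (X n \<omega>', f n (V n \<omega>))) \<partial>M n) \<in> borel_measurable (M n)"
      by measurable
    have "c n \<omega> = (\<integral>\<omega>'. iexp (\<theta> * h n (X n \<omega>', f n (V n \<omega>))) \<partial>M n)" if "\<omega> \<in> space (M n)" for \<omega>
      unfolding c_def char_def by (subst integral_distr) (simp_all add: meas[OF that])
    then have "c n \<in> borel_measurable (M n) \<longleftrightarrow>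
        (\<lambda>\<omega>. \<integral>\<omega>'. iexp (\<theta> * h n (X n \<omega>', f n (V n \<omega>))) \<partial>M n) \<in> borel_measurable (M n)"
      by (rule measurable_cong)
    then show ?thesis using int_meas by (rule iffD2)
  qed
  then show "c n \<in> borel_measurable (M n)" .
  have c_bound: "cmod (c n \<omega> - ?\<phi>) \<le> 2" if "\<omega> \<in> space (M n)" for n \<omega>
  proof -
    have "cmod (c n \<omega>) \<le> 1"
      unfolding c_def by (intro real_distribution.cmod_char_le_1 M.real_distribution_distr meas that)
    moreover have "cmod ?\<phi> \<le> 1"
      by (intro real_distribution.cmod_char_le_1 real_dist_normal_dist)
    ultimately show ?thesis using norm_triangle_ineq4[of "c n \<omega>" ?\<phi>] by linarith
  qed
  let ?P = "\<lambda>t n. cond_prob_given (M n) (F n) (\<lambda>\<omega>. f n (V n \<omega>)) (\<lambda>\<omega>. h n (X n \<omega>, f n (V n \<omega>)) \<le> t)"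
  have P_meas[measurable]: "?P t n \<in> borel_measurable (M n)" for t n
    unfolding cond_prob_given_def by (rule borel_measurable_cond_exp2)
  show "(\<lambda>n. \<integral>\<omega>. cmod (c n \<omega> - ?\<phi>) \<partial>M n) \<longlonglongrightarrow> 0"
  proof (rule tendstoI)
    fix e :: real assume e: "0 < e"
    obtain R :: "real set" and \<delta> where R: "finite R" and \<delta>: "0 < \<delta>"
      and close: "\<And>\<mu>. real_distribution \<mu> \<Longrightarrow>
        (\<And>t. t \<in> R \<Longrightarrow> \<bar>cdf \<mu> t - cdf std_normal_distribution t\<bar> \<le> \<delta>) \<Longrightarrow> cmod (char \<mu> \<theta> - ?\<phi>) < e / 2"
      by (rule char_close_of_cdf_close[OF real_dist_normal_dist, of "e / 2" \<theta>])
         (use e isCont_Phi in \<open>auto simp: Phi_def\<close>)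
    \<comment> \<open>The exceptional event. A union bound over the finite set \<open>R\<close>
      makes its probability less than \<open>e / 4\<close> eventually, so with the bound 2 it
      contributes less than \<open>e / 2\<close>.\<close>
    define A where "A n = (\<Union>t\<in>R. {\<omega> \<in> space (M n). \<delta> < \<bar>?P t n \<omega> - Phi t\<bar>})" for n
    have A_sets[measurable]: "A n \<in> sets (M n)" for n
      unfolding A_def using R by (intro sets.finite_UN) auto
    have "(\<lambda>n. \<Sum>t\<in>R. measure (M n) {\<omega> \<in> space (M n). \<delta> < \<bar>?P t n \<omega> - Phi t\<bar>}) \<longlonglongrightarrow> (\<Sum>t\<in>R. 0)"
      using valid \<delta> by (intro tendsto_sum) (simp add: tendsto_in_prob_def)
    then have "\<forall>\<^sub>F n in sequentially. (\<Sum>t\<in>R. measure (M n) {\<omega> \<in> space (M n). \<delta> < \<bar>?P t n \<omega> - Phi t\<bar>}) < e / 4"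
      using e by (intro order_tendstoD) auto
    then show "\<forall>\<^sub>F n in sequentially. dist (\<integral>\<omega>. cmod (c n \<omega> - ?\<phi>) \<partial>M n) 0 < e"
    proof eventually_elim
      case (elim n)
      have "measure (M n) (A n) \<le> (\<Sum>t\<in>R. measure (M n) {\<omega> \<in> space (M n). \<delta> < \<bar>?P t n \<omega> - Phi t\<bar>})"
        unfolding A_def using R by (intro M.finite_measure_subadditive_finite) auto
      with elim have A_small: "measure (M n) (A n) < e / 4" by simp
      have "AE \<omega> in M n. \<forall>t\<in>R. ?P t n \<omega> = cdf (distr (M n) borel (\<lambda>\<omega>'. h n (X n \<omega>', f n (V n \<omega>)))) t"
        using R M.cond_prob_given_indep[OF indep f h] by (intro AE_finite_allI) auto
      then have "AE \<omega> in M n. cmod (c n \<omega> - ?\<phi>) \<le> e / 2 + 2 * indicator (A n) \<omega>"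
        using AE_space
      proof eventually_elim
        case (elim \<omega>)
        show ?case
        proof (cases "\<omega> \<in> A n")
          case True
          then show ?thesis using c_bound[OF elim(2)] e by simp
        next
          case False
          have "cmod (c n \<omega> - ?\<phi>) < e / 2"
            unfolding c_def
          proof (rule close)
            show "real_distribution (distr (M n) borel (\<lambda>\<omega>'. h n (X n \<omega>', f n (V n \<omega>))))"
              by (intro M.real_distribution_distr meas elim)
            show "\<bar>cdf (distr (M n) borel (\<lambda>\<omega>'. h n (X n \<omega>', f n (V n \<omega>)))) t
                - cdf std_normal_distribution t\<bar> \<le> \<delta>" if "t \<in> R" for t
            proof -
              have "\<bar>?P t n \<omega> - Phi t\<bar> \<le> \<delta>"
                using False that elim(2) by (auto simp: A_def not_less)
              then show ?thesis using elim(1) that by (simp add: Phi_def)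
            qed
          qed
          then show ?thesis using False by simp
        qed
      qed
      moreover have "integrable (M n) (\<lambda>\<omega>. cmod (c n \<omega> - ?\<phi>))"
        by (rule M.integrable_const_bound[where B = 2]) (auto intro!: AE_I2 c_bound)
      ultimately have "(\<integral>\<omega>. cmod (c n \<omega> - ?\<phi>) \<partial>M n) \<le> (\<integral>\<omega>. e / 2 + 2 * indicator (A n) \<omega> \<partial>M n)"
        by (intro integral_mono_AE) (auto simp: M.emeasure_eq_measure)
      also have "\<dots> = e / 2 + 2 * measure (M n) (A n)"
        by (simp add: M.prob_space M.emeasure_eq_measure)
      also have "\<dots> < e" using A_small by simp
      finally show ?case by (simp add: dist_real_def)
    qed
  qed
qed

text \<open>This serves the induction over the folds: \<open>s\<close> is the sum so far, a function
  of the past \<open>V\<close>, and \<open>h\<close> the new statistic, which sees \<open>V\<close>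
  only through the estimate. The new summand need not be independent of the past, but its frozen
  characteristic function is asymptotically nonrandom and so factors out in the limit.\<close>

lemma char_add_tendsto:
  fixes M :: "nat \<Rightarrow> 'w measure" and X V :: "nat \<Rightarrow> 'w \<Rightarrow> 'b" and h :: "nat \<Rightarrow> 'b \<times> 'f \<Rightarrow> real"
  assumes prob: "\<And>n. prob_space (M n)"
    and indep: "\<And>n. prob_space.indep_var (M n) (S n) (X n) (N n) (V n)"
    and f: "\<And>n. f n \<in> N n \<rightarrow>\<^sub>M F n"
    and h: "\<And>n. h n \<in> borel_measurable (S n \<Otimes>\<^sub>M F n)"
    and s: "\<And>n. s n \<in> borel_measurable (N n)"
    and valid: "\<And>t. tendsto_in_prob M
      (\<lambda>n. cond_prob_given (M n) (F n) (\<lambda>\<omega>. f n (V n \<omega>)) (\<lambda>\<omega>. h n (X n \<omega>, f n (V n \<omega>)) \<le> t)) (Phi t)"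
    and conv: "(\<lambda>n. char (distr (M n) borel (\<lambda>\<omega>. s n (V n \<omega>))) \<theta>) \<longlonglongrightarrow> L"
  shows "(\<lambda>n. char (distr (M n) borel (\<lambda>\<omega>. s n (V n \<omega>) + h n (X n \<omega>, f n (V n \<omega>)))) \<theta>)
    \<longlonglongrightarrow> L * char std_normal_distribution \<theta>"
proof -
  interpret M: prob_space "M n" for n by (rule prob)
  note [measurable] = f h s
  have [measurable]: "X n \<in> M n \<rightarrow>\<^sub>M S n" "V n \<in> M n \<rightarrow>\<^sub>M N n" for n
    using M.indep_var_rv1[OF indep] M.indep_var_rv2[OF indep] by auto
  let ?\<phi> = "char std_normal_distribution \<theta>"
  define c where "c n \<omega> = char (distr (M n) borel (\<lambda>\<omega>'. h n (X n \<omega>', f n (V n \<omega>)))) \<theta>" for n \<omega>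
  note L1 = tendsto_in_prob_char[OF prob indep f h valid, where \<theta> = \<theta>, folded c_def]
  have [measurable]: "c n \<in> borel_measurable (M n)" for n
    using L1(1) .
  let ?r = "\<lambda>n. \<integral>\<omega>. iexp (\<theta> * s n (V n \<omega>)) * (c n \<omega> - ?\<phi>) \<partial>M n"
  have split: "char (distr (M n) borel (\<lambda>\<omega>. s n (V n \<omega>) + h n (X n \<omega>, f n (V n \<omega>)))) \<theta>
      = ?r n + char (distr (M n) borel (\<lambda>\<omega>. s n (V n \<omega>))) \<theta> * ?\<phi>" for n
  proof -
    have c_le: "cmod (c n \<omega>) \<le> 1" if "\<omega> \<in> space (M n)" for \<omega>
    proof -
      have "f n (V n \<omega>) \<in> space (F n)"
        using that measurable_space[OF f] measurable_space[OF M.indep_var_rv2[OF indep]] by blast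
      then have "(\<lambda>\<omega>'. h n (X n \<omega>', f n (V n \<omega>))) \<in> borel_measurable (M n)" by measurable
      then show ?thesis
        unfolding c_def by (intro real_distribution.cmod_char_le_1 M.real_distribution_distr)
    qed
    have int: "integrable (M n) (\<lambda>\<omega>. iexp (\<theta> * s n (V n \<omega>)) * c n \<omega>)"
      "integrable (M n) (\<lambda>\<omega>. iexp (\<theta> * s n (V n \<omega>)) * ?\<phi>)"
      by (auto intro!: M.integrable_const_bound[where B = 1] simp: norm_mult c_le
          real_distribution.cmod_char_le_1[OF real_dist_normal_dist])
    have h': "(\<lambda>(x, v). h n (x, f n v)) \<in> borel_measurable (S n \<Otimes>\<^sub>M N n)" by measurable
    have "char (distr (M n) borel (\<lambda>\<omega>. s n (V n \<omega>) + h n (X n \<omega>, f n (V n \<omega>)))) \<theta>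
        = (\<integral>\<omega>. iexp (\<theta> * s n (V n \<omega>)) * c n \<omega> \<partial>M n)"
      using M.char_add_indep[OF indep h' s, where \<theta> = \<theta>] by (simp add: c_def)
    also have "\<dots> = ?r n + (\<integral>\<omega>. iexp (\<theta> * s n (V n \<omega>)) * ?\<phi> \<partial>M n)"
      using int by (subst Bochner_Integration.integral_add[symmetric]) (simp_all add: right_diff_distrib)
    also have "(\<integral>\<omega>. iexp (\<theta> * s n (V n \<omega>)) * ?\<phi> \<partial>M n) = char (distr (M n) borel (\<lambda>\<omega>. s n (V n \<omega>))) \<theta> * ?\<phi>"
      unfolding char_def[of "distr _ _ _"] by (subst integral_distr) simp_all
    finally show ?thesis .
  qed
  have "?r \<longlonglongrightarrow> 0"
  proof (rule Lim_null_comparison)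
    show "(\<lambda>n. \<integral>\<omega>. cmod (c n \<omega> - ?\<phi>) \<partial>M n) \<longlonglongrightarrow> 0" by (rule L1(2))
    show "\<forall>\<^sub>F n in sequentially. cmod (?r n) \<le> (\<integral>\<omega>. cmod (c n \<omega> - ?\<phi>) \<partial>M n)"
    proof (rule always_eventually, rule allI)
      fix n
      have "cmod (?r n) \<le> (\<integral>\<omega>. cmod (iexp (\<theta> * s n (V n \<omega>)) * (c n \<omega> - ?\<phi>)) \<partial>M n)"
        by (rule integral_norm_bound)
      then show "cmod (?r n) \<le> (\<integral>\<omega>. cmod (c n \<omega> - ?\<phi>) \<partial>M n)"
        by (simp add: norm_mult)
    qed
  qed
  then have "(\<lambda>n. ?r n + char (distr (M n) borel (\<lambda>\<omega>. s n (V n \<omega>))) \<theta> * ?\<phi>) \<longlonglongrightarrow> 0 + L * ?\<phi>"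
    by (intro tendsto_add tendsto_mult conv tendsto_const)
  then show ?thesis by (simp add: split)
qed

section \<open>Induction over the folds and the limit of the p-value\<close>

theorem proposition1:
  fixes K :: nat
    and M :: "nat \<Rightarrow> 'w measure"
    and Zs :: "'z measure"
    and Z :: "nat \<Rightarrow> nat \<Rightarrow> 'w \<Rightarrow> 'z"
    and Y :: "nat \<Rightarrow> nat \<Rightarrow> bool \<Rightarrow> 'w \<Rightarrow> real"
    and D :: "nat \<Rightarrow> nat \<Rightarrow> 'w \<Rightarrow> bool"
    and \<pi> :: real
    and \<tau> :: "'z \<Rightarrow> real"
    and B :: "nat \<Rightarrow> nat \<Rightarrow> nat set"
    and \<sigma> :: "nat \<Rightarrow> 'w \<Rightarrow> nat \<Rightarrow> nat"
    and W :: "nat \<Rightarrow> nat \<Rightarrow> 'w \<Rightarrow> nat \<Rightarrow> 'z \<times> real \<times> bool"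
    and Fs :: "nat \<Rightarrow> nat \<Rightarrow> ('z \<Rightarrow> real) measure"
    and est :: "nat \<Rightarrow> nat \<Rightarrow> (nat \<Rightarrow> nat \<Rightarrow> 'z \<times> real \<times> bool) \<Rightarrow> 'z \<Rightarrow> real"
    and \<tau>hat :: "nat \<Rightarrow> nat \<Rightarrow> 'w \<Rightarrow> 'z \<Rightarrow> real"
    and test :: "nat \<Rightarrow> nat \<Rightarrow> (nat \<Rightarrow> 'z \<times> real \<times> bool) \<times> ('z \<Rightarrow> real) \<Rightarrow> real"
    and T :: "nat \<Rightarrow> nat \<Rightarrow> 'w \<Rightarrow> real"
  assumes K: "K \<ge> 2"
    and split: "\<And>n. random_split (M n) n Zs (Z n) (Y n) (D n) \<pi> \<tau> K (B n) (\<sigma> n)"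
    and W_def: "\<And>n k. W n k = fold_data (B n k) (\<sigma> n) (observation (Z n) (Y n) (D n))"
    and est_measurable: "\<And>n k. k \<in> {2..K} \<Longrightarrow>
      est n k \<in> (\<Pi>\<^sub>M j\<in>{1..k-1}. fold_space Zs (B n j)) \<rightarrow>\<^sub>M Fs n k"
    and \<tau>hat_def: "\<And>n k \<omega>. \<tau>hat n k \<omega> = est n k (\<lambda>j\<in>{1..k-1}. W n j \<omega>)"
    and test_measurable: "\<And>n k. k \<in> {2..K} \<Longrightarrow>
      test n k \<in> borel_measurable (fold_space Zs (B n k) \<Otimes>\<^sub>M Fs n k)"
    and T_def: "\<And>n k \<omega>. T n k \<omega> = test n k (W n k \<omega>, \<tau>hat n k \<omega>)"
    and folds_indep: "\<And>n. prob_space.indep_vars (M n) (\<lambda>k. fold_space Zs (B n k)) (W n) {1..K}"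
    and valid: "\<And>k t. k \<in> {2..K} \<Longrightarrow>
      tendsto_in_prob M
        (\<lambda>n. cond_prob_given (M n) (Fs n k) (\<tau>hat n k) (\<lambda>\<omega>. T n k \<omega> \<le> t)) (Phi t)"
  shows "weak_conv_m
    (\<lambda>n. distr (M n) borel (\<lambda>\<omega>. seq_p_value K (\<lambda>k. T n k \<omega>)))
    (uniform_measure lborel {0..1})"
proof -
  interpret S: random_split "M n" n Zs "Z n" "Y n" "D n" \<pi> \<tau> K "B n" "\<sigma> n" for n by (rule split)
  let ?N = "\<lambda>n A. \<Pi>\<^sub>M j\<in>A. fold_space Zs (B n j)"
  \<comment> \<open>The statistic of fold \<open>j\<close> as a function of fold data. The
    restriction cuts a vector over more folds back to the input of the estimator, so the same
    function serves vectors over \<open>{1..k}\<close> for every \<open>k \<ge> j\<close>.\<close>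
  define stat where "stat n j v = test n j (v j, est n j (restrict v {1..j-1}))" for n j v
  have T_eq: "T n j \<omega> = stat n j (\<lambda>i\<in>A. W n i \<omega>)" if "{1..j} \<subseteq> A" "1 \<le> j" for n j A \<omega>
  proof -
    have "{1..j-1} \<subseteq> {1..j}" by auto
    then have "A \<inter> {1..j-1} = {1..j-1}" using that(1) by blast
    then have "restrict (\<lambda>i\<in>A. W n i \<omega>) {1..j-1} = (\<lambda>i\<in>{1..j-1}. W n i \<omega>)"
      by (simp only: restrict_restrict)
    moreover have "j \<in> A" using that by auto
    ultimately show ?thesis by (simp add: T_def \<tau>hat_def stat_def)
  qed
  have stat_meas: "stat n j \<in> borel_measurable (?N n {1..k})" if "2 \<le> j" "j \<le> k" "k \<le> K" for n j k
  proof -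
    have "(\<lambda>v. restrict v {1..j-1}) \<in> ?N n {1..k} \<rightarrow>\<^sub>M ?N n {1..j-1}"
      using that by (intro measurable_restrict_subset) auto
    from measurable_compose[OF this est_measurable]
    have "(\<lambda>v. est n j (restrict v {1..j-1})) \<in> ?N n {1..k} \<rightarrow>\<^sub>M Fs n j"
      using that by simp
    moreover have "(\<lambda>v. v j) \<in> ?N n {1..k} \<rightarrow>\<^sub>M fold_space Zs (B n j)"
      using that by (intro measurable_component_singleton) auto
    ultimately show ?thesis
      unfolding stat_def[abs_def]
      using that by (intro measurable_compose[OF measurable_Pair test_measurable]) auto
  qed
  have W_meas: "(\<lambda>\<omega>. \<lambda>j\<in>{1..K}. W n j \<omega>) \<in> M n \<rightarrow>\<^sub>M ?N n {1..K}" for n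
    using folds_indep[of n] by (intro measurable_restrict) (simp add: S.indep_vars_def)
  have T_meas: "T n j \<in> borel_measurable (M n)" if "2 \<le> j" "j \<le> K" for n j
  proof -
    have "(\<lambda>\<omega>. stat n j (\<lambda>i\<in>{1..K}. W n i \<omega>)) \<in> borel_measurable (M n)"
      using that by (intro measurable_compose[OF W_meas stat_meas]) auto
    moreover have "T n j = (\<lambda>\<omega>. stat n j (\<lambda>i\<in>{1..K}. W n i \<omega>))"
      using that by (intro ext T_eq) auto
    ultimately show ?thesis by (simp only:)
  qed
  have sum_T_meas: "(\<lambda>\<omega>. \<Sum>j=2..K. T n j \<omega>) \<in> borel_measurable (M n)" for n
    by (intro borel_measurable_sum T_meas) auto
  \<comment> \<open>The exponent counts the summands from 2 to \<open>k\<close>. The induction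
    starts at 1, where the sum is empty, because the first fold is used only for estimation.\<close>
  have char_sum: "(\<lambda>n. char (distr (M n) borel (\<lambda>\<omega>. \<Sum>j=2..k. T n j \<omega>)) \<theta>)
      \<longlonglongrightarrow> char std_normal_distribution \<theta> ^ (k - 1)" if "1 \<le> k" "k \<le> K" for k \<theta>
    using that
  proof (induction k rule: dec_induct)
    case base
    have "char (distr (M n) borel (\<lambda>\<omega>. 0)) \<theta> = 1" for n
      unfolding char_def by (subst integral_distr) (simp_all add: S.prob_space)
    then show ?case by simp
  next
    case (step k)
    \<comment> \<open>Keeping the new fold as a function on a one-point index set gives
      \<open>X\<close> and \<open>V\<close> the same type, and their independence follows by
      grouping the folds into disjoint blocks.\<close>
    define X where "X n \<omega> = (\<lambda>j\<in>{Suc k}. W n j \<omega>)" for n \<omega>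
    define V where "V n \<omega> = (\<lambda>j\<in>{1..k}. W n j \<omega>)" for n \<omega>
    define s where "s n v = (\<Sum>j=2..k. stat n j v)" for n v
    define h where "h n z = test n (Suc k) (fst z (Suc k), snd z)" for n and z :: "(nat \<Rightarrow> nat \<Rightarrow> 'z \<times> real \<times> bool) \<times> ('z \<Rightarrow> real)"
    have k: "Suc k \<in> {2..K}" "k \<le> K" using step.hyps step.prems by auto
    have indep: "S.indep_var n (?N n {Suc k}) (X n) (?N n {1..k}) (V n)" for n
      unfolding X_def[abs_def] V_def[abs_def]
      using k by (intro S.indep_var_restrict[OF folds_indep]) auto
    \<comment> \<open>The estimate for fold \<open>Suc k\<close> takes the folds
      \<open>1, ..., Suc k - 1\<close>, which are exactly the coordinates of
      \<open>V\<close>.\<close>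
    have f: "est n (Suc k) \<in> ?N n {1..k} \<rightarrow>\<^sub>M Fs n (Suc k)" for n
      using est_measurable[OF k(1), of n] by simp
    have h: "h n \<in> borel_measurable (?N n {Suc k} \<Otimes>\<^sub>M Fs n (Suc k))" for n
      unfolding h_def[abs_def]
      by (intro measurable_compose[OF measurable_Pair test_measurable] k(1) measurable_snd
          measurable_compose[OF measurable_fst measurable_component_singleton]) simp
    have s: "s n \<in> borel_measurable (?N n {1..k})" for n
      unfolding s_def[abs_def] using k by (intro borel_measurable_sum stat_meas) auto
    have s_V: "s n (V n \<omega>) = (\<Sum>j=2..k. T n j \<omega>)" for n \<omega>
      unfolding s_def V_def by (intro sum.cong refl T_eq[symmetric]) auto
    have \<tau>hat_V: "est n (Suc k) (V n \<omega>) = \<tau>hat n (Suc k) \<omega>" for n \<omega>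
      by (simp add: V_def \<tau>hat_def)
    have h_X: "h n (X n \<omega>, \<tau>hat n (Suc k) \<omega>) = T n (Suc k) \<omega>" for n \<omega>
      by (simp add: h_def X_def T_def)
    have "(\<lambda>n. char (distr (M n) borel (\<lambda>\<omega>. s n (V n \<omega>) + h n (X n \<omega>, est n (Suc k) (V n \<omega>)))) \<theta>)
        \<longlonglongrightarrow> char std_normal_distribution \<theta> ^ (k - 1) * char std_normal_distribution \<theta>"
    proof (rule char_add_tendsto[OF S.prob_space_axioms indep f h s])
      show "tendsto_in_prob M (\<lambda>n. cond_prob_given (M n) (Fs n (Suc k)) (\<lambda>\<omega>. est n (Suc k) (V n \<omega>))
          (\<lambda>\<omega>. h n (X n \<omega>, est n (Suc k) (V n \<omega>)) \<le> t)) (Phi t)" for t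
        unfolding \<tau>hat_V h_X using valid[OF k(1), of t] by simp
      show "(\<lambda>n. char (distr (M n) borel (\<lambda>\<omega>. s n (V n \<omega>))) \<theta>) \<longlonglongrightarrow> char std_normal_distribution \<theta> ^ (k - 1)"
        unfolding s_V using step.IH k by simp
    qed
    moreover have "(\<Sum>j=2..k. T n j \<omega>) + T n (Suc k) \<omega> = (\<Sum>j=2..Suc k. T n j \<omega>)" for n \<omega>
      using step.hyps by (simp add: sum.cl_ivl_Suc)
    \<comment> \<open>The subtraction is truncated, so \<open>1 \<le> k\<close> matters
      here.\<close>
    moreover have "char std_normal_distribution \<theta> ^ (k - 1) * char std_normal_distribution \<theta>
        = char std_normal_distribution \<theta> ^ (Suc k - 1)"
      using step.hyps by (cases k) simp_all
    ultimately show ?case by (simp only: s_V \<tau>hat_V h_X)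
  qed
  define S where "S n \<omega> = 1 / sqrt (real K - 1) * (\<Sum>j=2..K. T n j \<omega>)" for n \<omega>
  have S_meas: "S n \<in> borel_measurable (M n)" for n
    unfolding S_def[abs_def] by (intro borel_measurable_times borel_measurable_const sum_T_meas)
  have "weak_conv_m (\<lambda>n. distr (M n) borel (S n)) std_normal_distribution"
  proof (rule levy_continuity)
    show "real_distribution (distr (M n) borel (S n))" for n
      by (rule S.real_distribution_distr[OF S_meas])
    show "real_distribution std_normal_distribution" by (rule real_dist_normal_dist)
    fix \<theta> :: real
    \<comment> \<open>Scaling the sum amounts to evaluating its characteristic function at
      \<open>?a\<close>.\<close>
    let ?a = "\<theta> / sqrt (real K - 1)"
    have "char (distr (M n) borel (S n)) \<theta> = char (distr (M n) borel (\<lambda>\<omega>. \<Sum>j=2..K. T n j \<omega>)) ?a" for n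
    proof -
      have "char (distr (M n) borel (S n)) \<theta> = (\<integral>\<omega>. iexp (\<theta> * S n \<omega>) \<partial>M n)"
        unfolding char_def by (rule integral_distr[OF S_meas]) simp
      also have "\<dots> = (\<integral>\<omega>. iexp (?a * (\<Sum>j=2..K. T n j \<omega>)) \<partial>M n)"
        by (simp only: S_def mult.assoc[symmetric] times_divide_eq_right mult_1_right)
      also have "\<dots> = char (distr (M n) borel (\<lambda>\<omega>. \<Sum>j=2..K. T n j \<omega>)) ?a"
        unfolding char_def by (rule integral_distr[OF sum_T_meas, symmetric]) simp
      finally show ?thesis .
    qed
    \<comment> \<open>The normalization is exact: \<open>K - 1\<close> factors
      \<open>exp (- ?a\<^sup>2 / 2)\<close> multiply to
      \<open>exp (- \<theta>\<^sup>2 / 2)\<close>.\<close>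
    moreover have "char std_normal_distribution ?a ^ (K - 1) = char std_normal_distribution \<theta>"
    proof -
      have "real (K - 1) * (- (?a\<^sup>2) / 2) = - \<theta>\<^sup>2 / 2"
        using K by (simp add: power_divide field_simps)
      then show ?thesis
        by (simp add: char_std_normal_distribution of_real_power[symmetric] exp_of_nat_mult[symmetric]
            del: of_real_power)
    qed
    ultimately show "(\<lambda>n. char (distr (M n) borel (S n)) \<theta>) \<longlonglongrightarrow> char std_normal_distribution \<theta>"
      using char_sum[of K ?a] K by simp
  qed
  then have "weak_conv_m (\<lambda>n. distr (distr (M n) borel (S n)) borel (\<lambda>x. 2 * Phi (- \<bar>x\<bar>)))
      (distr std_normal_distribution borel (\<lambda>x. 2 * Phi (- \<bar>x\<bar>)))"
    by (intro weak_conv_distr_continuous S.real_distribution_distr S_meas real_dist_normal_dist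
        isCont_two_sided_p_value)
  moreover have "distr (distr (M n) borel (S n)) borel (\<lambda>x. 2 * Phi (- \<bar>x\<bar>))
      = distr (M n) borel (\<lambda>\<omega>. seq_p_value K (\<lambda>k. T n k \<omega>))" for n
  proof -
    have "(\<lambda>x. 2 * Phi (- \<bar>x\<bar>)) \<in> borel_measurable borel"
      by (intro borel_measurable_continuous_onI continuous_at_imp_continuous_on ballI
          isCont_two_sided_p_value)
    then show ?thesis
      by (subst distr_distr) (simp_all add: S_meas comp_def S_def seq_p_value_def)
  qed
  ultimately show ?thesis
    by (simp add: std_normal_two_sided_p_value)
qed

end
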